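(* Let $\mathcal{H}$ and $\mathcal{G}$ be real finite-dimensional Hilbert spaces, let $g:\mathcal{H}\to\overline{\mathbb{R}}$ and $h:\mathcal{G}\to\overline{\mathbb{R}}$ be proper, convex and lower semicontinuous, let $\varphi:\mathcal{H}\to\mathbb{R}$ be convex and Fréchet differentiable with $\frac1\beta$-Lipschitz continuous gradient for some $\beta>0$, and let $K:\mathcal{H}\to\mathcal{G}$ be linear with adjoint $K^*$. Let $(\gamma_n)_{n\ge0}$ and $(\mu_n)_{n\ge0}$ be sequences of positive numbers, let $(x_0,y_0)\in\mathcal{H}\times\mathcal{G}$, and for $n\ge0$ let $$x_{n+1}=\operatorname{Prox}_{\gamma_n g}\big(x_n+\gamma_nK^*y_n-\gamma_n\nabla\varphi(x_n)\big),\qquad y_{n+1}=\operatorname{Prox}_{\mu_nh^*}\big(y_n+\mu_nKx_{n+1}\big).$$ Let $\Phi(x,y)=g(x)+\varphi(x)+h^*(y)-\langle y,Kx\rangle$. Then for each $n\ge0$, $$\Phi(x_{n+1},y_{n+1})\le\Phi(x_{n+1},y_n)\le\Phi(x_n,y_n),$$ provided that $0<\gamma_n\le2\beta$.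
   Context: $\overline{\mathbb{R}}=\mathbb{R}\cup\{+\infty,-\infty\}$. A function is proper if it never takes the value $-\infty$ and is not identically $+\infty$. The conjugate of $f$ is $f^*(x^* )=\sup_x\{\langle x^*,x\rangle-f(x)\}$. For $f$ proper, convex and lower semicontinuous and $\gamma>0$, $\operatorname{Prox}_{\gamma f}(x)$ is the unique minimizer over $y$ of $\gamma f(y)+\frac12\|y-x\|^2$. *)

theory Defs
  imports "HOL-Analysis.Analysis"
begin

definition proper_fun :: "('a \<Rightarrow> ereal) \<Rightarrow> bool" where
  "proper_fun f \<longleftrightarrow> (\<forall>x. f x \<noteq> -\<infinity>) \<and> (\<exists>x. f x \<noteq> \<infinity>)"

(* With 0 < t < 1 and the convention \<infinity> + (-\<infinity>) = \<infinity> of ereal, this says that the epigraph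
   of f is convex, also for functions that take the value -\<infinity>. *)
definition convex_fun :: "('a::real_vector \<Rightarrow> ereal) \<Rightarrow> bool" where
  "convex_fun f \<longleftrightarrow> (\<forall>x y. \<forall>t::real. 0 < t \<and> t < 1 \<longrightarrow>
     f (t *\<^sub>R x + (1 - t) *\<^sub>R y) \<le> ereal t * f x + ereal (1 - t) * f y)"

definition lsc_fun :: "('a::topological_space \<Rightarrow> ereal) \<Rightarrow> bool" where
  "lsc_fun f \<longleftrightarrow> (\<forall>x. f x \<le> Liminf (at x) f)"

definition conjugate :: "('a::real_inner \<Rightarrow> ereal) \<Rightarrow> 'a \<Rightarrow> ereal" where
  "conjugate f u = (SUP x. ereal (u \<bullet> x) - f x)"

(* prox c f x is Prox_{c f}(x). The definite description is meaningful only when the minimizer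
   exists and is unique, as for c > 0 and f proper, convex and lower semicontinuous on a
   finite-dimensional space. *)
definition prox :: "real \<Rightarrow> ('a::real_inner \<Rightarrow> ereal) \<Rightarrow> 'a \<Rightarrow> 'a" where
  "prox c f x = (THE p. \<forall>y. ereal c * f p + ereal (1/2 * (norm (p - x))\<^sup>2)
                          \<le> ereal c * f y + ereal (1/2 * (norm (y - x))\<^sup>2))"

end

theory Submission
  imports Defs
begin

text \<open>The optimality condition of a proximal step is the subgradient inequality
  \<open>f u \<ge> f p + \<langle>x - p, u - p\<rangle> / c\<close> for \<open>p = prox c f x\<close>. For the dual step it gives the first
  inequality at once. For the primal step, at \<open>u = x\<^sub>n\<close>, it is added to the descent lemma
  \<open>\<phi> p \<le> \<phi> x\<^sub>n + \<langle>\<nabla>\<phi> x\<^sub>n, p - x\<^sub>n\<rangle> + \<parallel>p - x\<^sub>n\<parallel>\<^sup>2 / (2\<beta>)\<close>, which leaves a decrease of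
  \<open>(1/\<gamma>\<^sub>n - 1/(2\<beta>)) \<parallel>p - x\<^sub>n\<parallel>\<^sup>2 \<ge> 0\<close>.\<close>

section \<open>Finite-dimensional inner product spaces: expansions, compact balls, adjoints\<close>

text \<open>Gram-Schmidt gives an orthogonal spanning set; the residual of \<open>v\<close> is
  orthogonal to all of it, hence to itself. A zero vector in \<open>C\<close> is harmless, since its
  summand vanishes.\<close>

lemma finite_span_orthogonal_expansion:
  assumes "\<exists>B::'a::real_inner set. finite B \<and> span B = UNIV"
  obtains C :: "'a::real_inner set" where "finite C" "\<And>v. v = (\<Sum>c\<in>C. (v \<bullet> c / (c \<bullet> c)) *\<^sub>R c)"
proof -
  obtain B :: "'a set" where "finite B" "span B = UNIV" using assms by blast
  with basis_orthogonal[of B] obtain C :: "'a set" where C: "finite C" "span C = UNIV" "pairwise orthogonal C"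
    by metis
  have "v = (\<Sum>c\<in>C. (v \<bullet> c / (c \<bullet> c)) *\<^sub>R c)" for v
  proof -
    define w where "w = v - (\<Sum>c\<in>C. (v \<bullet> c / (c \<bullet> c)) *\<^sub>R c)"
    have "orthogonal w d" if d: "d \<in> C" for d
    proof -
      have "(\<Sum>c\<in>C. (v \<bullet> c / (c \<bullet> c)) * (c \<bullet> d)) = (v \<bullet> d / (d \<bullet> d)) * (d \<bullet> d)"
        using C(3) d by (subst sum.remove[OF C(1) d])
          (auto simp: pairwise_def orthogonal_def inner_commute intro!: sum.neutral)
      then show ?thesis
        by (cases "d = 0") (auto simp: w_def orthogonal_def inner_diff_left inner_sum_left)
    qed
    then have "orthogonal w w" using C(2) orthogonal_to_span[of w C w] by auto
    then show ?thesis by (simp add: w_def orthogonal_def)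
  qed
  with C(1) that show thesis by blast
qed

text \<open>Adding a vector \<open>d\<close> to \<open>C\<close> takes the Minkowski sum with the
  compact segment of multiples of \<open>d\<close>.\<close>

lemma compact_bounded_combinations:
  fixes C :: "'a::real_normed_vector set"
  assumes "finite C"
  shows "compact {v. \<exists>a. (\<forall>c\<in>C. \<bar>a c\<bar> \<le> (M c::real)) \<and> v = (\<Sum>c\<in>C. a c *\<^sub>R c)}"
  using assms
proof induction
  case empty
  then show ?case by simp
next
  case (insert d C)
  let ?S = "{v. \<exists>a. (\<forall>c\<in>C. \<bar>a c\<bar> \<le> M c) \<and> v = (\<Sum>c\<in>C. a c *\<^sub>R c)}"
  let ?T = "(\<lambda>t. t *\<^sub>R d) ` {- M d..M d}"
  have "compact ?T" by (intro compact_continuous_image continuous_intros) simp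
  then have "compact {u + v | u v. u \<in> ?T \<and> v \<in> ?S}"
    using insert.IH by (rule compact_sums)
  moreover have "{u + v | u v. u \<in> ?T \<and> v \<in> ?S}
    = {v. \<exists>a. (\<forall>c\<in>insert d C. \<bar>a c\<bar> \<le> M c) \<and> v = (\<Sum>c\<in>insert d C. a c *\<^sub>R c)}" (is "?L = ?R")
  proof (intro equalityI subsetI)
    fix w assume "w \<in> ?L"
    then obtain t a where "t \<in> {- M d..M d}" and
      a: "\<forall>c\<in>C. \<bar>a c\<bar> \<le> M c" "w = t *\<^sub>R d + (\<Sum>c\<in>C. a c *\<^sub>R c)"
      by blast
    then have t: "\<bar>t\<bar> \<le> M d" by auto
    have "(\<Sum>c\<in>C. (a(d := t)) c *\<^sub>R c) = (\<Sum>c\<in>C. a c *\<^sub>R c)"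
      using insert.hyps by (intro sum.cong) auto
    with t a insert.hyps show "w \<in> ?R"
      by (intro CollectI exI[of _ "a(d := t)"]) auto
  next
    fix w assume "w \<in> ?R"
    then obtain a where a: "\<forall>c\<in>insert d C. \<bar>a c\<bar> \<le> M c" "w = (\<Sum>c\<in>insert d C. a c *\<^sub>R c)"
      by blast
    have "a d *\<^sub>R d \<in> ?T" using a(1) by (intro imageI) (auto simp: abs_le_iff)
    moreover have "(\<Sum>c\<in>C. a c *\<^sub>R c) \<in> ?S" using a(1) by auto
    moreover have "w = a d *\<^sub>R d + (\<Sum>c\<in>C. a c *\<^sub>R c)" using a(2) insert.hyps by simp
    ultimately show "w \<in> ?L" by blast
  qed
  ultimately show ?case by simp
qed

text \<open>By Cauchy-Schwarz, points of the ball have bounded coefficients in the orthogonal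
  expansion, so the ball is a closed part of a compact set.\<close>

lemma finite_span_compact_cball:
  fixes z :: "'a::real_inner"
  assumes "\<exists>B::'a set. finite B \<and> span B = UNIV"
  shows "compact (cball z r)"
proof -
  obtain C :: "'a set" where C: "finite C" "\<And>v. v = (\<Sum>c\<in>C. (v \<bullet> c / (c \<bullet> c)) *\<^sub>R c)"
    using finite_span_orthogonal_expansion[OF assms] by blast
  define R where "R = norm z + r"
  let ?S = "{v. \<exists>a. (\<forall>c\<in>C. \<bar>a c\<bar> \<le> R * norm c / (c \<bullet> c)) \<and> v = (\<Sum>c\<in>C. a c *\<^sub>R c)}"
  have "cball z r \<subseteq> ?S"
  proof
    fix v assume "v \<in> cball z r"
    then have "norm v \<le> R"
      using norm_triangle_ineq2[of v z] by (simp add: R_def dist_norm norm_minus_commute)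
    then have "\<bar>v \<bullet> c\<bar> \<le> R * norm c" for c
      by (meson Cauchy_Schwarz_ineq2 mult_right_mono norm_ge_zero order_trans)
    then have "\<bar>v \<bullet> c / (c \<bullet> c)\<bar> \<le> R * norm c / (c \<bullet> c)" for c
      by (simp add: abs_divide divide_right_mono)
    with C(2)[of v] show "v \<in> ?S"
      by (intro CollectI exI[of _ "\<lambda>c. v \<bullet> c / (c \<bullet> c)"]) simp
  qed
  moreover have "compact (?S \<inter> cball z r)"
    by (rule compact_Int_closed[OF compact_bounded_combinations[OF C(1)] closed_cball])
  ultimately show ?thesis by (simp only: Int_absorb1)
qed

text \<open>\<open>adjoint\<close> is defined by choice, so the identity follows once some adjoint
  exists. Expanding \<open>u\<close> in \<open>C\<close> before applying \<open>K\<close> yields the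
  explicit one, \<open>A\<close>.\<close>

lemma finite_span_adjoint_works:
  fixes K :: "'a::real_inner \<Rightarrow> 'b::real_inner"
  assumes "\<exists>B::'a set. finite B \<and> span B = UNIV" and K: "linear K"
  shows "u \<bullet> adjoint K v = K u \<bullet> v"
proof -
  obtain C :: "'a set" where C: "\<And>v. v = (\<Sum>c\<in>C. (v \<bullet> c / (c \<bullet> c)) *\<^sub>R c)"
    using finite_span_orthogonal_expansion[OF assms(1)] by blast
  define A where "A v = (\<Sum>c\<in>C. (K c \<bullet> v / (c \<bullet> c)) *\<^sub>R c)" for v
  have "K u \<bullet> v = u \<bullet> A v" for u v
  proof -
    have "K u = (\<Sum>c\<in>C. (u \<bullet> c / (c \<bullet> c)) *\<^sub>R K c)"
      by (subst C[of u]) (simp add: linear_sum[OF K] linear_scale[OF K])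
    then show ?thesis
      by (simp add: A_def inner_sum_left inner_sum_right mult.commute)
  qed
  then have "\<forall>u v. K u \<bullet> v = u \<bullet> A v" by blast
  then have "\<forall>u v. K u \<bullet> v = u \<bullet> adjoint K v"
    unfolding adjoint_def by (rule someI[where P = "\<lambda>f. \<forall>u v. K u \<bullet> v = u \<bullet> f v"])
  then show ?thesis by simp
qed

section \<open>Lower semicontinuity and attained minima\<close>

text \<open>Punctured and full neighbourhoods differ only in \<open>x\<close> itself, where
  \<open>a < f x\<close> is already assumed.\<close>

lemma lsc_fun_iff_eventually:
  "lsc_fun f \<longleftrightarrow> (\<forall>x. \<forall>a < f x. eventually (\<lambda>y. a < f y) (nhds x))"
  unfolding lsc_fun_def le_Liminf_iff eventually_nhds_conv_at by blast

text \<open>If the infimum \<open>I\<close> were not attained, the open sets where \<open>f\<close>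
  exceeds some \<open>a > I\<close> would cover \<open>S\<close>. The least level of a finite
  subcover would then be a lower bound of \<open>f\<close> above \<open>I\<close>.\<close>

lemma lsc_fun_attains_inf:
  assumes f: "lsc_fun f" and S: "compact S" "S \<noteq> {}"
  obtains p where "p \<in> S" "\<And>u. u \<in> S \<Longrightarrow> f p \<le> f u"
proof (rule ccontr)
  define I where "I = (INF u\<in>S. f u)"
  assume "\<not> thesis"
  with that have no: "\<And>p. p \<in> S \<Longrightarrow> \<exists>u\<in>S. f u < f p" by (meson not_le)
  have "open {x. a < f x}" for a
    using f by (subst open_subopen)
      (metis (mono_tags, lifting) eventually_nhds lsc_fun_iff_eventually mem_Collect_eq subsetI)
  moreover have "S \<subseteq> (\<Union>a\<in>{I<..}. {x. a < f x})"
  proof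
    fix p assume "p \<in> S"
    then obtain u where "u \<in> S" "f u < f p" using no by blast
    moreover have "I \<le> f u" using \<open>u \<in> S\<close> by (simp add: I_def INF_lower)
    ultimately have "I < f p" by simp
    then obtain a where "I < a" "a < f p" using dense by blast
    then show "p \<in> (\<Union>a\<in>{I<..}. {x. a < f x})" by auto
  qed
  ultimately obtain A where A: "A \<subseteq> {I<..}" "finite A" "S \<subseteq> (\<Union>a\<in>A. {x. a < f x})"
    using compactE_image[OF S(1)] by metis
  then have "A \<noteq> {}" using S(2) by auto
  then have "I < Min A" using A by auto
  moreover have "Min A \<le> I"
    unfolding I_def
  proof (rule INF_greatest)
    fix p assume "p \<in> S"
    then obtain a where "a \<in> A" "a < f p" using A(3) by auto
    then show "Min A \<le> f p" using Min_le[OF A(2)] by (meson le_less_trans less_imp_le)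
  qed
  ultimately show False by simp
qed

lemma proper_funE_finite:
  assumes "proper_fun f" "f u \<noteq> \<infinity>"
  obtains r where "f u = ereal r"
  using assms unfolding proper_fun_def by (cases "f u") auto

lemma lsc_fun_scale_add_continuous:
  fixes f :: "'a::topological_space \<Rightarrow> ereal"
  assumes f: "lsc_fun f" "proper_fun f" and c: "c > 0" and q: "continuous_on UNIV q"
  shows "lsc_fun (\<lambda>u. ereal c * f u + ereal (q u))"
  unfolding lsc_fun_iff_eventually
proof (intro allI impI)
  fix z a assume a: "a < ereal c * f z + ereal (q z)"
  have fin: "f u \<noteq> -\<infinity>" for u using f(2) by (simp add: proper_fun_def)
  show "eventually (\<lambda>u. a < ereal c * f u + ereal (q u)) (nhds z)"
  proof (cases a)
    case (real r)
    have "ereal ((r - q z) / c) < f z"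
      using a real c fin[of z] by (cases "f z") (auto simp: field_simps)
    \<comment> \<open>The real \<open>b\<close> splits the strict inequality: \<open>b < f u\<close>
      persists near \<open>z\<close> by lower semicontinuity, and \<open>r < c * b + q u\<close> by
      continuity of \<open>q\<close>.\<close>
    then obtain b where b: "(r - q z) / c < b" "ereal b < f z"
      by (metis ereal_dense2 ereal_less_eq(3) less_ereal.simps(1))
    have "r < c * b + q z" using b(1) c by (simp add: field_simps)
    moreover have "((\<lambda>u. c * b + q u) \<longlongrightarrow> c * b + q z) (nhds z)"
      using q by (intro tendsto_intros) (auto simp: continuous_on_def tendsto_at_iff_tendsto_nhds)
    ultimately have "eventually (\<lambda>u. r < c * b + q u) (nhds z)" by (rule order_tendstoD(1)[rotated])
    moreover have "eventually (\<lambda>u. ereal b < f u) (nhds z)"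
      using f(1) b(2) by (simp add: lsc_fun_iff_eventually)
    ultimately show ?thesis
    proof eventually_elim
      case (elim u)
      show ?case
      proof (cases "f u")
        case (real s)
        then have "c * b < c * s" using elim(2) c by simp
        then show ?thesis using elim(1) real \<open>a = ereal r\<close> by simp
      qed (use c fin in \<open>auto simp: \<open>a = ereal r\<close>\<close>)
    qed
  next
    case PInf
    then show ?thesis using a by simp
  next
    case MInf
    have "a < ereal c * f u + ereal (q u)" for u
      using MInf c fin[of u] by (cases "f u") auto
    then show ?thesis by simp
  qed
qed

section \<open>Proximal points: existence, optimality condition, uniqueness\<close>

definition prox_objective :: "real \<Rightarrow> ('a::real_inner \<Rightarrow> ereal) \<Rightarrow> 'a \<Rightarrow> 'a \<Rightarrow> ereal" where
  "prox_objective c f x u = ereal c * f u + ereal (1/2 * (norm (u - x))\<^sup>2)"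

text \<open>Supplies coercivity of the proximal objective. With \<open>m\<close> the minimum of
  \<open>f\<close> on the unit ball around \<open>z\<close>, convexity along rays from
  \<open>z\<close> prevents \<open>f\<close> from falling faster than with slope
  \<open>A - m\<close> beyond that ball.\<close>

lemma convex_fun_linear_lower_bound:
  fixes f :: "'a::real_inner \<Rightarrow> ereal"
  assumes fin: "\<exists>B::'a set. finite B \<and> span B = UNIV"
    and f: "proper_fun f" "convex_fun f" "lsc_fun f" and z: "f z = ereal A"
  obtains D where "D \<ge> 0" "\<And>u. norm (u - z) \<ge> 1 \<Longrightarrow> ereal (A - D * norm (u - z)) \<le> f u"
proof -
  obtain p where p: "\<And>u. u \<in> cball z 1 \<Longrightarrow> f p \<le> f u"
    using lsc_fun_attains_inf[OF f(3) finite_span_compact_cball[OF fin], of z 1]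
    by (metis cball_eq_empty not_one_less_zero)
  have "f p \<le> ereal A" using p[of z] z by simp
  then obtain m where m: "f p = ereal m" "m \<le> A"
    using f(1) by (cases "f p") (auto simp: proper_fun_def)
  have "ereal (A - (A - m) * norm (u - z)) \<le> f u" if u: "norm (u - z) \<ge> 1" for u
  proof (cases "f u")
    case (real b)
    show ?thesis
    proof (cases "norm (u - z) = 1")
      case True
      then show ?thesis using p[of u] m real by (simp add: dist_norm norm_minus_commute)
    next
      case False
      define r where "r = norm (u - z)"
      have r: "r > 1" using False u by (simp add: r_def)
      \<comment> \<open>The point where the segment from \<open>z\<close> to \<open>u\<close>
        crosses the unit sphere around \<open>z\<close>.\<close>
      define v where "v = (1/r) *\<^sub>R u + (1 - 1/r) *\<^sub>R z"
      have "v - z = (1/r) *\<^sub>R (u - z)" by (simp add: v_def algebra_simps)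
      then have "norm (v - z) = 1" using r by (simp add: r_def[symmetric])
      then have "ereal m \<le> f v" using p[of v] m by (simp add: dist_norm norm_minus_commute)
      also have "f v \<le> ereal (1/r) * f u + ereal (1 - 1/r) * f z"
        using f(2) r unfolding convex_fun_def v_def by simp
      finally have "m \<le> (1/r) * b + (1 - 1/r) * A" using real z by simp
      then have "r * m \<le> r * ((1/r) * b + (1 - 1/r) * A)" using r by (intro mult_left_mono) auto
      also have "\<dots> = b + (r - 1) * A" using r by (simp add: field_simps)
      finally show ?thesis using real by (simp add: r_def[symmetric] algebra_simps)
    qed
  qed (use f(1) in \<open>auto simp: proper_fun_def\<close>)
  with m(2) show thesis using that[of "A - m"] by simp
qed

text \<open>The quadratic term beats the linear lower bound of \<open>f\<close> far from
  \<open>z\<close>, so a minimizer over a large enough compact ball is global.\<close>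

lemma prox_objective_has_minimizer:
  fixes f :: "'a::real_inner \<Rightarrow> ereal"
  assumes fin: "\<exists>B::'a set. finite B \<and> span B = UNIV"
    and f: "proper_fun f" "convex_fun f" "lsc_fun f" and c: "c > 0"
  obtains p where "\<And>u. prox_objective c f x p \<le> prox_objective c f x u"
proof -
  obtain z where "f z \<noteq> \<infinity>" using f(1) by (auto simp: proper_fun_def)
  then obtain A where A: "f z = ereal A" by (rule proper_funE_finite[OF f(1)])
  obtain D where D: "D \<ge> 0" "\<And>u. norm (u - z) \<ge> 1 \<Longrightarrow> ereal (A - D * norm (u - z)) \<le> f u"
    using convex_fun_linear_lower_bound[OF fin f A] by blast
  define d where "d = norm (z - x)"
  \<comment> \<open>Radius at least 1 makes the linear bound applicable. For \<open>r\<close> at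
    least twice \<open>d + c * D\<close>, half the square of \<open>r\<close> dominates
    \<open>r * (d + c * D)\<close>; hence outside the ball the objective is at least its value at
    \<open>z\<close>.\<close>
  define R where "R = max 1 (2 * (d + c * D))"
  let ?F = "prox_objective c f x"
  have "lsc_fun ?F"
    unfolding prox_objective_def [abs_def]
    by (intro lsc_fun_scale_add_continuous f c continuous_intros)
  moreover have "cball z R \<noteq> {}" by (auto simp: R_def)
  ultimately obtain p where p: "\<And>u. u \<in> cball z R \<Longrightarrow> ?F p \<le> ?F u"
    using lsc_fun_attains_inf finite_span_compact_cball[OF fin] by metis
  have "?F p \<le> ?F u" for u
  proof (cases "u \<in> cball z R")
    case False
    define r where "r = norm (u - z)"
    have r: "r \<ge> 1" "r \<ge> 2 * (d + c * D)"
      using False by (auto simp: r_def R_def dist_norm norm_minus_commute)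
    have d: "d \<ge> 0" by (simp add: d_def)
    have rd: "r - d \<le> norm (u - x)"
      unfolding r_def d_def using norm_triangle_ineq2[of "u - z" "x - z"]
      by (simp add: norm_minus_commute)
    have "r \<ge> d" using r d D(1) c by (smt (verit) mult_nonneg_nonneg)
    then have sq: "(r - d)\<^sup>2 \<le> (norm (u - x))\<^sup>2" using rd by (intro power_mono) auto
    have "r * (2 * (d + c * D)) \<le> r * r" using r by (intro mult_left_mono) auto
    then have "c * A + 1/2 * d\<^sup>2 \<le> c * (A - D * r) + 1/2 * (r - d)\<^sup>2"
      by (simp add: algebra_simps power2_eq_square)
    also have "\<dots> \<le> c * (A - D * r) + 1/2 * (norm (u - x))\<^sup>2" using sq by simp
    finally have *: "c * A + 1/2 * d\<^sup>2 \<le> c * (A - D * r) + 1/2 * (norm (u - x))\<^sup>2" .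
    have "?F p \<le> ?F z" by (rule p) (simp add: R_def)
    also have "?F z = ereal (c * A + 1/2 * d\<^sup>2)" by (simp add: prox_objective_def A d_def)
    also have "\<dots> \<le> ereal c * ereal (A - D * r) + ereal (1/2 * (norm (u - x))\<^sup>2)" using * by simp
    also have "\<dots> \<le> ?F u"
      unfolding prox_objective_def using D(2)[of u] r(1) c
      by (intro add_mono ereal_mult_left_mono) (auto simp: r_def)
    finally show ?thesis .
  qed (rule p)
  with that show thesis by blast
qed

text \<open>First-order optimality: compare \<open>p\<close> with the points at parameter
  \<open>t\<close> on the segment to \<open>u\<close>, bound \<open>f\<close> there by convexity,
  divide by \<open>t\<close> and let \<open>t\<close> tend to 0.\<close>

lemma prox_objective_minimizer_subgradient:
  fixes f :: "'a::real_inner \<Rightarrow> ereal"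
  assumes f: "proper_fun f" "convex_fun f" and c: "c > 0"
    and p: "\<And>u. prox_objective c f x p \<le> prox_objective c f x u"
  obtains a where "f p = ereal a" "\<And>u. ereal (a + ((x - p) \<bullet> (u - p)) / c) \<le> f u"
proof -
  obtain z where "f z \<noteq> \<infinity>" using f(1) by (auto simp: proper_fun_def)
  then obtain A where A: "f z = ereal A" by (rule proper_funE_finite[OF f(1)])
  have "f p \<noteq> \<infinity>" using p[of z] c A by (auto simp: prox_objective_def)
  then obtain a where a: "f p = ereal a" by (rule proper_funE_finite[OF f(1)])
  have "ereal (a + ((x - p) \<bullet> (u - p)) / c) \<le> f u" for u
  proof (cases "f u")
    case (real b)
    \<comment> \<open>The slack of the claimed inequality, scaled by \<open>c\<close>; it is bounded
      below by a quantity that vanishes with \<open>t\<close>.\<close>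
    define s where "s = c * (b - a) - (x - p) \<bullet> (u - p)"
    have lower: "- (t * (norm (u - p))\<^sup>2 / 2) \<le> s" if t: "0 < t" "t < 1" for t
    proof -
      define v where "v = t *\<^sub>R u + (1 - t) *\<^sub>R p"
      have "f v \<le> ereal t * f u + ereal (1 - t) * f p"
        using f(2) t unfolding convex_fun_def v_def by simp
      then have fv: "f v \<le> ereal (t * b + (1 - t) * a)" using real a by simp
      have "prox_objective c f x p \<le> ereal c * f v + ereal (1/2 * (norm (v - x))\<^sup>2)"
        using p[of v] by (simp add: prox_objective_def)
      also have "\<dots> \<le> ereal c * ereal (t * b + (1 - t) * a) + ereal (1/2 * (norm (v - x))\<^sup>2)"
        using c fv by (intro add_mono ereal_mult_left_mono) auto
      finally have 1: "c * a + 1/2 * (norm (p - x))\<^sup>2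
          \<le> c * (t * b + (1 - t) * a) + 1/2 * (norm (v - x))\<^sup>2"
        by (simp add: prox_objective_def a)
      have "v - x = (p - x) + t *\<^sub>R (u - p)" by (simp add: v_def algebra_simps)
      then have "(norm (v - x))\<^sup>2
          = (norm (p - x))\<^sup>2 + 2 * t * ((p - x) \<bullet> (u - p)) + t\<^sup>2 * (norm (u - p))\<^sup>2"
        by (simp only: power2_norm_eq_inner inner_add_left inner_add_right
            inner_scaleR_left inner_scaleR_right inner_commute[of "u - p" "p - x"])
          (simp add: power2_eq_square distrib_left mult.assoc)
      with 1 have "0 \<le> t * (c * (b - a) + (p - x) \<bullet> (u - p) + t * (norm (u - p))\<^sup>2 / 2)"
        by (simp add: algebra_simps power2_eq_square)
      then have "0 \<le> c * (b - a) + (p - x) \<bullet> (u - p) + t * (norm (u - p))\<^sup>2 / 2"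
        using t by (simp add: zero_le_mult_iff)
      then show ?thesis by (simp add: s_def inner_diff_left)
    qed
    have "((\<lambda>t. - (t * (norm (u - p))\<^sup>2 / 2)) \<longlongrightarrow> - (0 * (norm (u - p))\<^sup>2 / 2)) (at_right 0)"
      by (intro tendsto_intros) simp
    moreover have "eventually (\<lambda>t::real. - (t * (norm (u - p))\<^sup>2 / 2) \<le> s) (at_right 0)"
      unfolding eventually_at_right_field using lower by (intro exI[of _ 1]) auto
    ultimately have "- (0 * (norm (u - p))\<^sup>2 / 2) \<le> s"
      by (rule tendsto_upperbound) simp
    then have "0 \<le> s" by simp
    then show ?thesis using c real by (simp add: s_def field_simps)
  qed (use f(1) in \<open>auto simp: proper_fun_def\<close>)
  with a that show thesis by blast
qed

text \<open>Transfers the optimality condition to \<open>prox\<close>, whose definite description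
  requires the minimizer to be unique.\<close>

lemma prox_subgradient:
  fixes f :: "'a::real_inner \<Rightarrow> ereal"
  assumes fin: "\<exists>B::'a set. finite B \<and> span B = UNIV"
    and f: "proper_fun f" "convex_fun f" "lsc_fun f" and c: "c > 0"
  obtains a where "f (prox c f x) = ereal a"
    "\<And>u. ereal (a + ((x - prox c f x) \<bullet> (u - prox c f x)) / c) \<le> f u"
proof -
  obtain p where p: "\<And>u. prox_objective c f x p \<le> prox_objective c f x u"
    using prox_objective_has_minimizer[OF fin f c] by blast
  have unique: "q = p" if q: "\<And>u. prox_objective c f x q \<le> prox_objective c f x u" for q
  proof -
    obtain a where a: "f p = ereal a" "\<And>u. ereal (a + ((x - p) \<bullet> (u - p)) / c) \<le> f u"
      using prox_objective_minimizer_subgradient[OF f(1,2) c p] by blast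
    obtain b where b: "f q = ereal b" "\<And>u. ereal (b + ((x - q) \<bullet> (u - q)) / c) \<le> f u"
      using prox_objective_minimizer_subgradient[OF f(1,2) c q] by blast
    \<comment> \<open>Each subgradient inequality is tested at the other minimizer. In the sum the
      values of \<open>f\<close> cancel, leaving the squared distance of \<open>p\<close> and
      \<open>q\<close> at most 0.\<close>
    have "((x - p) \<bullet> (q - p)) / c + ((x - q) \<bullet> (p - q)) / c \<le> 0"
      using a(2)[of q] b(2)[of p] a(1) b(1) by simp
    then have "(x - p) \<bullet> (q - p) + (x - q) \<bullet> (p - q) \<le> 0"
      using c by (simp add: add_divide_distrib[symmetric] divide_le_0_iff)
    moreover have "(x - p) \<bullet> (q - p) + (x - q) \<bullet> (p - q) = (q - p) \<bullet> (q - p)"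
      by (simp add: inner_diff_left inner_diff_right inner_commute)
    ultimately show "q = p" by (metis eq_iff_diff_eq_0 inner_gt_zero_iff not_le)
  qed
  have "prox c f x = (THE q. \<forall>u. prox_objective c f x q \<le> prox_objective c f x u)"
    by (simp add: prox_def prox_objective_def)
  also have "\<dots> = p" using p unique by (intro the_equality) auto
  finally have "prox c f x = p" .
  then show thesis
    using prox_objective_minimizer_subgradient[OF f(1,2) c p] that by metis
qed

section \<open>The conjugate is again proper, convex and lower semicontinuous\<close>

lemma conjugate_upper: "ereal (u \<bullet> v) - f v \<le> conjugate f u"
  unfolding conjugate_def by (rule SUP_upper) simp

text \<open>A supremum of functions of \<open>u\<close> that are affine, or constantly
  \<open>-\<infinity>\<close> where \<open>f\<close> is \<open>\<infinity>\<close>.\<close>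

lemma convex_fun_conjugate:
  assumes "proper_fun f"
  shows "convex_fun (conjugate f)"
  unfolding convex_fun_def
proof (intro allI impI)
  fix u v and t :: real assume t: "0 < t \<and> t < 1"
  show "conjugate f (t *\<^sub>R u + (1 - t) *\<^sub>R v) \<le> ereal t * conjugate f u + ereal (1 - t) * conjugate f v"
    unfolding conjugate_def [of f "t *\<^sub>R u + (1 - t) *\<^sub>R v"]
  proof (rule SUP_least)
    fix w
    have "ereal ((t *\<^sub>R u + (1 - t) *\<^sub>R v) \<bullet> w) - f w
        \<le> ereal t * (ereal (u \<bullet> w) - f w) + ereal (1 - t) * (ereal (v \<bullet> w) - f w)"
      using assms t by (cases "f w") (auto simp: proper_fun_def inner_add_left algebra_simps)
    also have "\<dots> \<le> ereal t * conjugate f u + ereal (1 - t) * conjugate f v"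
      using t by (intro add_mono ereal_mult_left_mono conjugate_upper) auto
    finally show "ereal ((t *\<^sub>R u + (1 - t) *\<^sub>R v) \<bullet> w) - f w
        \<le> ereal t * conjugate f u + ereal (1 - t) * conjugate f v" .
  qed
qed

text \<open>A single \<open>w\<close> that witnesses \<open>a < conjugate f u\<close> still does so
  for nearby points, as its affine function is continuous.\<close>

lemma lsc_fun_conjugate:
  assumes "proper_fun f"
  shows "lsc_fun (conjugate f)"
  unfolding lsc_fun_iff_eventually
proof (intro allI impI)
  fix u a assume "a < conjugate f u"
  then obtain w where w: "a < ereal (u \<bullet> w) - f w"
    unfolding conjugate_def less_SUP_iff by blast
  then have "f w \<noteq> \<infinity>" by auto
  then obtain r where r: "f w = ereal r" by (rule proper_funE_finite[OF assms])
  have "((\<lambda>v. v \<bullet> w - r) \<longlongrightarrow> u \<bullet> w - r) (nhds u)"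
    by (intro tendsto_intros) (rule filterlim_ident)
  then have "((\<lambda>v. ereal (v \<bullet> w - r)) \<longlongrightarrow> ereal (u \<bullet> w - r)) (nhds u)" by simp
  then have "eventually (\<lambda>v. a < ereal (v \<bullet> w - r)) (nhds u)"
    using w r by (intro order_tendstoD(1)) auto
  then show "eventually (\<lambda>v. a < conjugate f v) (nhds u)"
  proof eventually_elim
    case (elim v)
    then show ?case using conjugate_upper[of v w f] r by simp
  qed
qed

text \<open>A proximal point of \<open>f\<close> yields a subgradient of \<open>f\<close>, at which the conjugate is finite;
  this replaces the separation argument.\<close>

lemma proper_fun_conjugate:
  fixes f :: "'a::real_inner \<Rightarrow> ereal"
  assumes fin: "\<exists>B::'a set. finite B \<and> span B = UNIV"
    and f: "proper_fun f" "convex_fun f" "lsc_fun f"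
  shows "proper_fun (conjugate f)"
proof -
  \<comment> \<open>With centre 0 and parameter 1 the subgradient at \<open>p\<close> is simply
    \<open>- p\<close>.\<close>
  define p where "p = prox 1 f 0"
  obtain a where a: "\<And>u. ereal (a + ((0 - p) \<bullet> (u - p)) / 1) \<le> f u"
    using prox_subgradient[OF fin f zero_less_one, of 0] unfolding p_def by blast
  have "conjugate f (- p) \<le> ereal (p \<bullet> (- p) - a)"
    unfolding conjugate_def
  proof (rule SUP_least)
    fix u
    show "ereal (- p \<bullet> u) - f u \<le> ereal (p \<bullet> (- p) - a)"
      using a[of u] by (cases "f u") (auto simp: inner_diff_right)
  qed
  then have "conjugate f (- p) \<noteq> \<infinity>" by auto
  obtain z where "f z \<noteq> \<infinity>" using f(1) by (auto simp: proper_fun_def)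
  then obtain A where A: "f z = ereal A" by (rule proper_funE_finite[OF f(1)])
  have "conjugate f u \<noteq> -\<infinity>" for u using conjugate_upper[of u z f] A by auto
  with \<open>conjugate f (- p) \<noteq> \<infinity>\<close> show ?thesis unfolding proper_fun_def by blast
qed

section \<open>The descent lemma\<close>

lemma lipschitz_gradient_descent:
  fixes \<phi> :: "'a::real_inner \<Rightarrow> real"
  assumes grad: "\<And>u. GDERIV \<phi> u :> G u" and lip: "L-lipschitz_on UNIV G"
  shows "\<phi> v \<le> \<phi> u + G u \<bullet> (v - u) + L / 2 * (norm (v - u))\<^sup>2"
proof -
  define d where "d = v - u"
  \<comment> \<open>Up to the constant \<open>\<phi> u\<close>, the gap between
    \<open>\<phi>\<close> on the segment and its quadratic bound. Cauchy-Schwarz and the Lipschitz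
    condition make its derivative nonpositive.\<close>
  define \<theta> where "\<theta> t = \<phi> (u + t *\<^sub>R d) - t * (G u \<bullet> d) - L / 2 * t\<^sup>2 * (norm d)\<^sup>2" for t
  have "\<theta> 1 \<le> \<theta> 0"
  proof (rule DERIV_nonpos_imp_nonincreasing[of 0 1 \<theta>])
    fix t :: real assume t: "0 \<le> t" "t \<le> 1"
    have "((\<lambda>t. \<phi> (u + t *\<^sub>R d)) has_derivative (\<lambda>s. (s *\<^sub>R d) \<bullet> G (u + t *\<^sub>R d))) (at t)"
      by (rule has_derivative_compose[OF _ grad[unfolded gderiv_def], of "\<lambda>t. u + t *\<^sub>R d"])
        (auto intro!: derivative_eq_intros)
    then have "((\<lambda>t. \<phi> (u + t *\<^sub>R d)) has_field_derivative G (u + t *\<^sub>R d) \<bullet> d) (at t)"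
      unfolding has_field_derivative_def
      by (rule has_derivative_subst) (auto simp: inner_commute mult.commute)
    then have D: "(\<theta> has_field_derivative G (u + t *\<^sub>R d) \<bullet> d - G u \<bullet> d - L * t * (norm d)\<^sup>2) (at t)"
      unfolding \<theta>_def [abs_def] by (auto intro!: derivative_eq_intros simp: algebra_simps)
    have "(G (u + t *\<^sub>R d) - G u) \<bullet> d \<le> norm (G (u + t *\<^sub>R d) - G u) * norm d"
      by (rule norm_cauchy_schwarz)
    also have "\<dots> \<le> (L * norm (t *\<^sub>R d)) * norm d"
      using lipschitz_onD[OF lip, of "u + t *\<^sub>R d" u]
      by (intro mult_right_mono) (auto simp: dist_norm)
    also have "\<dots> = L * t * (norm d)\<^sup>2" using t by (simp add: power2_eq_square)
    finally have "G (u + t *\<^sub>R d) \<bullet> d - G u \<bullet> d - L * t * (norm d)\<^sup>2 \<le> 0"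
      by (simp add: inner_diff_left)
    with D show "\<exists>y. (\<theta> has_real_derivative y) (at t) \<and> y \<le> 0" by blast
  qed simp
  then show ?thesis by (simp add: \<theta>_def d_def)
qed

section \<open>Descent of the objective in each block\<close>

theorem proposition2:
  fixes g :: "'h::real_inner \<Rightarrow> ereal"
    and h :: "'g::real_inner \<Rightarrow> ereal"
    and \<phi> :: "'h \<Rightarrow> real"
    and grad\<phi> :: "'h \<Rightarrow> 'h"
    and K :: "'h \<Rightarrow> 'g"
    and \<beta> :: real
    and \<gamma> \<mu> :: "nat \<Rightarrow> real"
    and x :: "nat \<Rightarrow> 'h"
    and y :: "nat \<Rightarrow> 'g"
    and \<Phi> :: "'h \<Rightarrow> 'g \<Rightarrow> ereal"
  assumes findim_H: "\<exists>B::'h set. finite B \<and> span B = UNIV"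
    and findim_G: "\<exists>B::'g set. finite B \<and> span B = UNIV"
    and g: "proper_fun g" "convex_fun g" "lsc_fun g"
    and h: "proper_fun h" "convex_fun h" "lsc_fun h"
    and phi_convex: "convex_on UNIV \<phi>"
    and phi_grad: "\<And>u. GDERIV \<phi> u :> grad\<phi> u"
    and beta: "\<beta> > 0"
    and grad_lipschitz: "(1/\<beta>)-lipschitz_on UNIV grad\<phi>"
    and K: "linear K"
    and gamma_pos: "\<And>n. \<gamma> n > 0"
    and mu_pos: "\<And>n. \<mu> n > 0"
    and x_step: "\<And>n. x (Suc n) =
      prox (\<gamma> n) g (x n + \<gamma> n *\<^sub>R adjoint K (y n) - \<gamma> n *\<^sub>R grad\<phi> (x n))"
    and y_step: "\<And>n. y (Suc n) =
      prox (\<mu> n) (conjugate h) (y n + \<mu> n *\<^sub>R K (x (Suc n)))"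
    and Phi: "\<And>u v. \<Phi> u v = g u + ereal (\<phi> u) + conjugate h v - ereal (v \<bullet> K u)"
  shows "\<forall>n. 0 < \<gamma> n \<and> \<gamma> n \<le> 2 * \<beta> \<longrightarrow>
    \<Phi> (x (Suc n)) (y (Suc n)) \<le> \<Phi> (x (Suc n)) (y n) \<and>
    \<Phi> (x (Suc n)) (y n) \<le> \<Phi> (x n) (y n)"
proof (intro allI impI conjI)
  fix n assume n: "0 < \<gamma> n \<and> \<gamma> n \<le> 2 * \<beta>"
  note hc = proper_fun_conjugate[OF findim_G h] convex_fun_conjugate[OF h(1)]
    lsc_fun_conjugate[OF h(1)]
  define p where "p = x (Suc n)"
  define q where "q = y (Suc n)"
  define w where "w = x n + \<gamma> n *\<^sub>R adjoint K (y n) - \<gamma> n *\<^sub>R grad\<phi> (x n)"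
  obtain a where a: "g p = ereal a" "\<And>u. ereal (a + ((w - p) \<bullet> (u - p)) / \<gamma> n) \<le> g u"
    using prox_subgradient[OF findim_H g gamma_pos, of n w] x_step[of n]
    unfolding p_def w_def by metis
  obtain b where b: "conjugate h q = ereal b"
    "\<And>v. ereal (b + ((y n + \<mu> n *\<^sub>R K p - q) \<bullet> (v - q)) / \<mu> n) \<le> conjugate h v"
    using prox_subgradient[OF findim_G hc mu_pos, of n "y n + \<mu> n *\<^sub>R K p"] y_step[of n]
    unfolding p_def q_def by metis
  have hfin: "conjugate h v \<noteq> -\<infinity>" for v using hc(1) by (simp add: proper_fun_def)
  have gfin: "g u \<noteq> -\<infinity>" for u using g(1) by (simp add: proper_fun_def)
  have "\<Phi> p q \<le> \<Phi> p (y n)"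
  \<comment> \<open>The starting point is arbitrary, so this value may be
    \<open>\<infinity>\<close>; the right-hand side is then \<open>\<infinity>\<close> too, because
    \<open>g p\<close> is finite.\<close>
  proof (cases "conjugate h (y n)")
    case (real s)
    \<comment> \<open>The dual subgradient inequality at \<open>y n\<close>: the squared norm is
      dropped, and the rest is exactly the change of the coupling term.\<close>
    have "(y n + \<mu> n *\<^sub>R K p - q) \<bullet> (y n - q) / \<mu> n
        = (norm (y n - q))\<^sup>2 / \<mu> n + K p \<bullet> (y n - q)"
      using mu_pos[of n]
      by (simp add: power2_norm_eq_inner inner_diff_left inner_diff_right inner_add_left field_simps)
    moreover have "(norm (y n - q))\<^sup>2 / \<mu> n \<ge> 0" using mu_pos[of n] by simp
    ultimately have "b + K p \<bullet> (y n - q) \<le> s" using b(2)[of "y n"] real by simp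
    then show ?thesis using a(1) b(1) real
      by (simp add: Phi inner_diff_right inner_commute)
  qed (use hfin a in \<open>auto simp: Phi\<close>)
  then show "\<Phi> (x (Suc n)) (y (Suc n)) \<le> \<Phi> (x (Suc n)) (y n)" by (simp add: p_def q_def)
  have "\<Phi> p (y n) \<le> \<Phi> (x n) (y n)"
  proof (cases "conjugate h (y n)")
    case (real s)
    show ?thesis
    proof (cases "g (x n)")
      case (real r)
      define d where "d = x n - p"
      \<comment> \<open>The adjoint term becomes the change of the coupling term; the gradient term
        cancels against the one in the descent lemma.\<close>
      have "(w - p) \<bullet> d / \<gamma> n = (norm d)\<^sup>2 / \<gamma> n + adjoint K (y n) \<bullet> d - grad\<phi> (x n) \<bullet> d"
        using n by (simp add: w_def d_def power2_norm_eq_inner inner_diff_left inner_diff_right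
            inner_add_left field_simps)
      moreover have "adjoint K (y n) \<bullet> d = y n \<bullet> K (x n) - y n \<bullet> K p"
        using finite_span_adjoint_works[OF findim_H K, of d "y n"]
        by (simp add: d_def inner_commute linear_diff[OF K] inner_diff_right)
      ultimately have 1: "a + (norm d)\<^sup>2 / \<gamma> n + y n \<bullet> K (x n) - y n \<bullet> K p - grad\<phi> (x n) \<bullet> d \<le> r"
        using a(2)[of "x n"] real by (simp add: d_def)
      have 2: "\<phi> p \<le> \<phi> (x n) - grad\<phi> (x n) \<bullet> d + 1 / (2 * \<beta>) * (norm d)\<^sup>2"
        using lipschitz_gradient_descent[OF phi_grad grad_lipschitz, of p "x n"]
        by (simp add: d_def inner_diff_right norm_minus_commute)
      \<comment> \<open>Here the step-size bound \<open>\<gamma> n \<le> 2 * \<beta>\<close>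
        enters.\<close>
      have "1 / (2 * \<beta>) * (norm d)\<^sup>2 \<le> 1 / \<gamma> n * (norm d)\<^sup>2"
        using n beta by (intro mult_right_mono) (auto simp: field_simps)
      with 1 2 have "a + \<phi> p - y n \<bullet> K p \<le> r + \<phi> (x n) - y n \<bullet> K (x n)" by simp
      then show ?thesis using a(1) real \<open>conjugate h (y n) = ereal s\<close> by (simp add: Phi)
    qed (use gfin real in \<open>auto simp: Phi\<close>)
  next
    case PInf
    then show ?thesis using gfin[of "x n"] by (cases "g (x n)") (auto simp: Phi)
  qed (use hfin in auto)
  then show "\<Phi> (x (Suc n)) (y n) \<le> \<Phi> (x n) (y n)" by (simp add: p_def)
qed

end
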